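(* Let $X$ be a Banach space of analytic functions on $\mathbb{D}$ and let $T\in\mathcal{L}(H(\mathbb{D}))$ be an injective operator satisfying $T(X)\subseteq X$, in which case $\|\cdot\|_{[T,X]}$ is a norm. The following three properties are equivalent. (i) The inclusion $[T,X]\subseteq H(\mathbb{D})$ is continuous. (ii) The evaluation functionals satisfy $\{\delta_z: z\in\mathbb{D}\}\subseteq [T,X]^*$ and, for each compact subset $K$ of $\mathbb{D}$, the set $\{\delta_w: w\in K\}$ is bounded in $[T,X]^*$. (iii) $([T,X],\|\cdot\|_{[T,X]})$ is a Banach space. If any one of (i)--(iii) is satisfied, then $[T,X]$ is a Banach space of analytic functions on $\mathbb{D}$ and $\{\delta_z: z\in\mathbb{D}\}\subseteq [T,X]^*$.
   Context: $\mathbb{D}$ is the open unit disc in $\mathbb{C}$; $H(\mathbb{D})$ is the Fréchet space of all analytic functions on $\mathbb{D}$ with the topology of uniform convergence on compact subsets of $\mathbb{D}$; $\mathcal{L}(E)$ denotes the space of continuous linear operators from $E$ into itself; $E^*$ is the topological dual of $E$, with the dual norm when $E$ is normed. For $z\in\mathbb{D}$, $\delta_z$ is the evaluation functional $f\mapsto f(z)$. A Banach space of analytic functions on $\mathbb{D}$ is a vector subspace $X\subseteq H(\mathbb{D})$ which is a Banach space for a norm $\|\cdot\|_X$ and such that the natural inclusion $X\to H(\mathbb{D})$ is continuous. For $T\in\mathcal{L}(H(\mathbb{D}))$ with $T(X)\subseteq X$, the optimal domain is $[T,X]:=\{f\in H(\mathbb{D}): Tf\in X\}$, endowed with the semi-norm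 $\|f\|_{[T,X]}:=\|Tf\|_X$. *)

theory Defs
  imports "HOL-Complex_Analysis.Complex_Analysis"
begin

text \<open>
  The space of holomorphic functions on the open unit disc. A function on the disc is represented
  by its extension by zero to the whole plane, so that equality in the type is equality on the disc.
\<close>

typedef hol_disc =
  "{f :: complex \<Rightarrow> complex. f holomorphic_on ball 0 1 \<and> (\<forall>z. z \<notin> ball 0 1 \<longrightarrow> f z = 0)}"
  morphisms hd_app Abs_hol_disc
  by (rule exI[of _ "\<lambda>_. 0"]) simp

setup_lifting type_definition_hol_disc

instantiation hol_disc :: ab_group_add
begin

lift_definition zero_hol_disc :: hol_disc is "\<lambda>_. 0" by simp

lift_definition plus_hol_disc :: "hol_disc \<Rightarrow> hol_disc \<Rightarrow> hol_disc" is "\<lambda>f g z. f z + g z"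
  by (simp add: holomorphic_on_add)

lift_definition minus_hol_disc :: "hol_disc \<Rightarrow> hol_disc \<Rightarrow> hol_disc" is "\<lambda>f g z. f z - g z"
  by (simp add: holomorphic_on_diff)

lift_definition uminus_hol_disc :: "hol_disc \<Rightarrow> hol_disc" is "\<lambda>f z. - f z"
  by (simp add: holomorphic_on_minus)

instance
  by (standard; transfer) (simp_all add: fun_eq_iff)

end

lift_definition hd_scale :: "complex \<Rightarrow> hol_disc \<Rightarrow> hol_disc" is "\<lambda>c f z. c * f z"
  by (simp add: holomorphic_on_mult[OF holomorphic_on_const])

global_interpretation hd: vector_space hd_scale
  by (standard; transfer) (simp_all add: fun_eq_iff algebra_simps)

text \<open>The topology of uniform convergence on compact subsets of the disc.\<close>

instantiation hol_disc :: topological_space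
begin

definition open_hol_disc :: "hol_disc set \<Rightarrow> bool" where
  "open_hol_disc U \<longleftrightarrow> (\<forall>f\<in>U. \<exists>K e. compact K \<and> K \<subseteq> ball 0 1 \<and> e > 0 \<and>
      (\<forall>g. (\<forall>z\<in>K. cmod (hd_app g z - hd_app f z) < e) \<longrightarrow> g \<in> U))"

instance
proof
  show "open (UNIV :: hol_disc set)"
    unfolding open_hol_disc_def
    by (rule ballI, rule exI[of _ "{}"], rule exI[of _ 1]) simp
next
  fix S T :: "hol_disc set"
  assume "open S" "open T"
  show "open (S \<inter> T)"
    unfolding open_hol_disc_def
  proof
    fix f assume f: "f \<in> S \<inter> T"
    obtain K d where K: "compact K \<and> K \<subseteq> ball 0 1 \<and> d > 0 \<and>
        (\<forall>g. (\<forall>z\<in>K. cmod (hd_app g z - hd_app f z) < d) \<longrightarrow> g \<in> S)"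
      using bspec[OF \<open>open S\<close>[unfolded open_hol_disc_def] IntD1[OF f]] by (elim exE)
    obtain L e where L: "compact L \<and> L \<subseteq> ball 0 1 \<and> e > 0 \<and>
        (\<forall>g. (\<forall>z\<in>L. cmod (hd_app g z - hd_app f z) < e) \<longrightarrow> g \<in> T)"
      using bspec[OF \<open>open T\<close>[unfolded open_hol_disc_def] IntD2[OF f]] by (elim exE)
    show "\<exists>K e. compact K \<and> K \<subseteq> ball 0 1 \<and> e > 0 \<and>
        (\<forall>g. (\<forall>z\<in>K. cmod (hd_app g z - hd_app f z) < e) \<longrightarrow> g \<in> S \<inter> T)"
      by (rule exI[of _ "K \<union> L"], rule exI[of _ "min d e"]) (use K L in \<open>simp add: compact_Un\<close>)
  qed
next
  fix C :: "hol_disc set set"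
  assume C: "\<forall>S\<in>C. open S"
  show "open (\<Union>C)"
    unfolding open_hol_disc_def
  proof
    fix f assume "f \<in> \<Union>C"
    then obtain S where S: "S \<in> C" "f \<in> S" by (elim UnionE)
    obtain K e where K: "compact K \<and> K \<subseteq> ball 0 1 \<and> e > 0 \<and>
        (\<forall>g. (\<forall>z\<in>K. cmod (hd_app g z - hd_app f z) < e) \<longrightarrow> g \<in> S)"
      using bspec[OF bspec[OF C S(1), unfolded open_hol_disc_def] S(2)] by (elim exE)
    show "\<exists>K e. compact K \<and> K \<subseteq> ball 0 1 \<and> e > 0 \<and>
        (\<forall>g. (\<forall>z\<in>K. cmod (hd_app g z - hd_app f z) < e) \<longrightarrow> g \<in> \<Union>C)"
      by (rule exI[of _ K], rule exI[of _ e]) (use K S(1) in blast)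
  qed
qed

end

text \<open>
  A normed space inside the type is a carrier \<open>E\<close> together with a function \<open>n\<close> whose values
  outside \<open>E\<close> are irrelevant.
\<close>

definition norm_on :: "hol_disc set \<Rightarrow> (hol_disc \<Rightarrow> real) \<Rightarrow> bool" where
  "norm_on E n \<longleftrightarrow> hd.subspace E \<and>
     (\<forall>f\<in>E. 0 \<le> n f) \<and>
     (\<forall>f\<in>E. n f = 0 \<longleftrightarrow> f = 0) \<and>
     (\<forall>c. \<forall>f\<in>E. n (hd_scale c f) = cmod c * n f) \<and>
     (\<forall>f\<in>E. \<forall>g\<in>E. n (f + g) \<le> n f + n g)"

text \<open>
  The locale \<^locale>\<open>Metric_space\<close> asks for nonnegativity and symmetry also outside the carrier,
  hence the case distinction.
\<close>

definition norm_dist :: "hol_disc set \<Rightarrow> (hol_disc \<Rightarrow> real) \<Rightarrow> hol_disc \<Rightarrow> hol_disc \<Rightarrow> real" where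
  "norm_dist E n f g = (if f \<in> E \<and> g \<in> E then n (f - g) else 0)"

definition norm_topology :: "hol_disc set \<Rightarrow> (hol_disc \<Rightarrow> real) \<Rightarrow> hol_disc topology" where
  "norm_topology E n = Metric_space.mtopology E (norm_dist E n)"

lemma Metric_space_norm_dist:
  assumes "norm_on E n"
  shows "Metric_space E (norm_dist E n)"
proof
  note n = assms[unfolded norm_on_def]
  have sub: "f - g \<in> E" if "f \<in> E" "g \<in> E" for f g
    by (rule hd.subspace_diff[OF conjunct1[OF n] that])
  have nonneg: "\<forall>f\<in>E. 0 \<le> n f" and zero: "\<forall>f\<in>E. n f = 0 \<longleftrightarrow> f = 0"
    and scale: "\<forall>c. \<forall>f\<in>E. n (hd_scale c f) = cmod c * n f"
    and triangle: "\<forall>f\<in>E. \<forall>g\<in>E. n (f + g) \<le> n f + n g"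
    using n by - (elim conjE, assumption)+
  show "0 \<le> norm_dist E n f g" for f g
    by (simp add: norm_dist_def nonneg sub)
  show "norm_dist E n f g = norm_dist E n g f" for f g
  proof (cases "f \<in> E \<and> g \<in> E")
    case True
    have "n (hd_scale (-1) (f - g)) = n (f - g)"
      using spec[OF scale, of "-1"] True by (simp add: sub del: hd.scale_minus_left)
    moreover have "hd_scale (-1) (f - g) = g - f"
      by (simp add: hd.scale_minus_left)
    ultimately show ?thesis using True by (simp add: norm_dist_def)
  next
    case False
    then show ?thesis by (auto simp: norm_dist_def)
  qed
  show "norm_dist E n f g = 0 \<longleftrightarrow> f = g" if "f \<in> E" "g \<in> E" for f g
    using that by (simp add: norm_dist_def zero sub)
  show "norm_dist E n f h \<le> norm_dist E n f g + norm_dist E n g h"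
    if "f \<in> E" "g \<in> E" "h \<in> E" for f g h
    using bspec[OF bspec[OF triangle sub[OF that(1,2)]] sub[OF that(2,3)]] that
    by (simp add: norm_dist_def)
qed

definition banach_space_on :: "hol_disc set \<Rightarrow> (hol_disc \<Rightarrow> real) \<Rightarrow> bool" where
  "banach_space_on E n \<longleftrightarrow> norm_on E n \<and> Metric_space.mcomplete E (norm_dist E n)"

definition continuous_inclusion :: "hol_disc set \<Rightarrow> (hol_disc \<Rightarrow> real) \<Rightarrow> bool" where
  "continuous_inclusion E n \<longleftrightarrow> continuous_map (norm_topology E n) euclidean (\<lambda>f. f)"

definition banach_space_of_analytic_functions :: "hol_disc set \<Rightarrow> (hol_disc \<Rightarrow> real) \<Rightarrow> bool" where
  "banach_space_of_analytic_functions X n \<longleftrightarrow> banach_space_on X n \<and> continuous_inclusion X n"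

text \<open>Functionals on \<open>E\<close> are represented by functions that are undefined outside \<open>E\<close>.\<close>

definition dual_space :: "hol_disc set \<Rightarrow> (hol_disc \<Rightarrow> real) \<Rightarrow> (hol_disc \<Rightarrow> complex) set" where
  "dual_space E n = {\<phi> \<in> extensional E.
     (\<forall>f\<in>E. \<forall>g\<in>E. \<phi> (f + g) = \<phi> f + \<phi> g) \<and>
     (\<forall>c. \<forall>f\<in>E. \<phi> (hd_scale c f) = c * \<phi> f) \<and>
     continuous_map (norm_topology E n) euclidean \<phi>}"

definition dual_norm :: "hol_disc set \<Rightarrow> (hol_disc \<Rightarrow> real) \<Rightarrow> (hol_disc \<Rightarrow> complex) \<Rightarrow> real" where
  "dual_norm E n \<phi> = (SUP f\<in>{f \<in> E. n f \<le> 1}. cmod (\<phi> f))"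

definition bounded_in_dual ::
    "hol_disc set \<Rightarrow> (hol_disc \<Rightarrow> real) \<Rightarrow> (hol_disc \<Rightarrow> complex) set \<Rightarrow> bool" where
  "bounded_in_dual E n B \<longleftrightarrow> B \<subseteq> dual_space E n \<and> (\<exists>M. \<forall>\<phi>\<in>B. dual_norm E n \<phi> \<le> M)"

definition delta :: "hol_disc set \<Rightarrow> complex \<Rightarrow> hol_disc \<Rightarrow> complex" where
  "delta E z = restrict (\<lambda>f. hd_app f z) E"

definition continuous_linear_operator :: "(hol_disc \<Rightarrow> hol_disc) \<Rightarrow> bool" where
  "continuous_linear_operator T \<longleftrightarrow>
     Vector_Spaces.linear hd_scale hd_scale T \<and> continuous_on UNIV T"

definition optimal_domain :: "(hol_disc \<Rightarrow> hol_disc) \<Rightarrow> hol_disc set \<Rightarrow> hol_disc set" where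
  "optimal_domain T X = {f. T f \<in> X}"

definition optimal_norm :: "(hol_disc \<Rightarrow> hol_disc) \<Rightarrow> (hol_disc \<Rightarrow> real) \<Rightarrow> hol_disc \<Rightarrow> real" where
  "optimal_norm T n f = n (T f)"

end

theory Submission
  imports Defs
begin

text \<open>
  Continuity of the inclusion of a normed space \<open>E\<close> of holomorphic functions means that on each compact
  \<open>K\<close> one has \<open>\<bar>f z\<bar> \<le> C * n f\<close>, which is a uniform bound for the evaluation functionals; this is
  (i) \<open>\<longleftrightarrow>\<close> (ii). For (i) \<open>\<longrightarrow>\<close> (iii), a Cauchy sequence of \<open>[T,X]\<close> converges locally uniformly to some \<open>g\<close>,
  while its image under \<open>T\<close> converges in \<open>X\<close>, necessarily to \<open>T g\<close>. For (iii) \<open>\<longrightarrow>\<close> (i), injectivity and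
  continuity of \<open>T\<close> show that the inclusion has closed graph, and the closed graph theorem for maps
  from a Banach space into the space of holomorphic functions applies. The latter follows from Baire's
  theorem by successive approximation: \<open>g\<close> is written as a series converging in norm whose \<open>j\<close>-th
  term is at most \<open>2^-j\<close> on the \<open>j\<close>-th disc of an exhaustion, so that the series also converges
  locally uniformly, to the same limit.
\<close>

subsection \<open>Locally uniform convergence on the disc\<close>

lemma hd_app_diff: "hd_app (f - g) z = hd_app f z - hd_app g z"
  by transfer simp

lemma hd_app_scale: "hd_app (hd_scale c f) z = c * hd_app f z"
  by transfer simp

lemma continuous_on_hd_app: "A \<subseteq> ball 0 1 \<Longrightarrow> continuous_on A (hd_app f)"
  by (rule continuous_on_subset[OF holomorphic_on_imp_continuous_on[where s = "ball 0 1"]])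
    (use hd_app[of f] in simp_all)

lemma hol_disc_eqI:
  assumes "\<And>z. z \<in> ball 0 1 \<Longrightarrow> hd_app f z = hd_app g z"
  shows "f = g"
proof -
  have "hd_app f z = hd_app g z" for z
    using assms[of z] hd_app[of f] hd_app[of g] by (cases "z \<in> ball 0 1") auto
  then show ?thesis
    by (simp add: hd_app_inject[symmetric] fun_eq_iff)
qed

lemma hd_app_bounded_on_compact:
  assumes "compact K" "K \<subseteq> ball 0 1"
  obtains B where "\<And>z. z \<in> K \<Longrightarrow> cmod (hd_app f z) \<le> B"
proof -
  have "bounded (hd_app f ` K)"
    by (simp add: assms compact_continuous_image compact_imp_bounded continuous_on_hd_app)
  then show ?thesis
    using that by (auto simp: bounded_iff)
qed

lemma open_uniform_nbhd:
  assumes K: "compact K" "K \<subseteq> ball 0 1"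
  shows "open {g. \<forall>z\<in>K. cmod (hd_app g z - hd_app f z) < e}"
  unfolding open_hol_disc_def
proof clarify
  fix g assume g: "\<forall>z\<in>K. cmod (hd_app g z - hd_app f z) < e"
  obtain m where m: "m < e" "\<And>z. z \<in> K \<Longrightarrow> cmod (hd_app g z - hd_app f z) \<le> m"
  proof (cases "K = {}")
    case True
    then show ?thesis using that[of "e - 1"] by simp
  next
    case False
    have "continuous_on K (\<lambda>z. cmod (hd_app g z - hd_app f z))"
      by (intro continuous_intros continuous_on_hd_app K)
    from continuous_attains_sup[OF K(1) False this]
    obtain x where "x \<in> K" "\<forall>z\<in>K. cmod (hd_app g z - hd_app f z) \<le> cmod (hd_app g x - hd_app f x)"
      by (elim bexE)
    then show ?thesis using that[of "cmod (hd_app g x - hd_app f x)"] g by simp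
  qed
  show "\<exists>K' e'. compact K' \<and> K' \<subseteq> ball 0 1 \<and> 0 < e' \<and>
      (\<forall>h. (\<forall>z\<in>K'. cmod (hd_app h z - hd_app g z) < e') \<longrightarrow>
        h \<in> {g. \<forall>z\<in>K. cmod (hd_app g z - hd_app f z) < e})"
  proof (intro exI[of _ K] exI[of _ "e - m"] conjI K allI impI CollectI ballI)
    fix h z
    assume h: "\<forall>z\<in>K. cmod (hd_app h z - hd_app g z) < e - m" and z: "z \<in> K"
    have "cmod (hd_app h z - hd_app f z)
        \<le> cmod (hd_app h z - hd_app g z) + cmod (hd_app g z - hd_app f z)"
      using norm_triangle_ineq[of "hd_app h z - hd_app g z" "hd_app g z - hd_app f z"] by simp
    then show "cmod (hd_app h z - hd_app f z) < e"
      using bspec[OF h z] m(2)[OF z] by linarith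
  qed (use m(1) in simp)
qed

lemma tendsto_hol_disc_iff:
  "(s \<longlongrightarrow> g) F \<longleftrightarrow>
    (\<forall>K. compact K \<longrightarrow> K \<subseteq> ball 0 1 \<longrightarrow> uniform_limit K (\<lambda>i. hd_app (s i)) (hd_app g) F)"
proof (intro iffI allI impI)
  fix K :: "complex set" assume s: "(s \<longlongrightarrow> g) F" and K: "compact K" "K \<subseteq> ball 0 1"
  show "uniform_limit K (\<lambda>i. hd_app (s i)) (hd_app g) F"
  proof (rule uniform_limitI)
    fix e :: real assume "e > 0"
    then show "\<forall>\<^sub>F i in F. \<forall>z\<in>K. dist (hd_app (s i) z) (hd_app g z) < e"
      using topological_tendstoD[OF s open_uniform_nbhd[OF K, of g e]] by (simp add: dist_norm)
  qed
next
  assume lim: "\<forall>K. compact K \<longrightarrow> K \<subseteq> ball 0 1 \<longrightarrow> uniform_limit K (\<lambda>i. hd_app (s i)) (hd_app g) F"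
  show "(s \<longlongrightarrow> g) F"
  proof (rule topological_tendstoI)
    fix U assume "open U" "g \<in> U"
    then obtain K e where K: "compact K" "K \<subseteq> ball 0 1" "e > 0"
      and U: "\<And>h. (\<forall>z\<in>K. cmod (hd_app h z - hd_app g z) < e) \<Longrightarrow> h \<in> U"
      unfolding open_hol_disc_def by metis
    have "\<forall>\<^sub>F i in F. \<forall>z\<in>K. dist (hd_app (s i) z) (hd_app g z) < e"
      using uniform_limitD[OF lim[rule_format, OF K(1,2)] K(3)] .
    then show "\<forall>\<^sub>F i in F. s i \<in> U"
      by eventually_elim (auto intro: U simp: dist_norm)
  qed
qed

lemma tendsto_hd_app:
  assumes "(s \<longlongrightarrow> g) F" "z \<in> ball 0 1"
  shows "((\<lambda>i. hd_app (s i) z) \<longlongrightarrow> hd_app g z) F"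
proof -
  have "uniform_limit {z} (\<lambda>i. hd_app (s i)) (hd_app g) F"
    using assms by (simp add: tendsto_hol_disc_iff del: uniform_limit_singleton)
  then show ?thesis by simp
qed

lemma hol_disc_tendsto_unique:
  fixes s :: "'a \<Rightarrow> hol_disc"
  assumes "(s \<longlongrightarrow> g) F" "(s \<longlongrightarrow> h) F" "F \<noteq> bot"
  shows "g = h"
proof (rule hol_disc_eqI)
  show "hd_app g z = hd_app h z" if "z \<in> ball 0 1" for z
    using tendsto_unique[OF assms(3) tendsto_hd_app[OF assms(1) that] tendsto_hd_app[OF assms(2) that]] .
qed

lemma hol_disc_complete:
  assumes cauchy: "\<And>K. compact K \<Longrightarrow> K \<subseteq> ball 0 1 \<Longrightarrow> uniformly_Cauchy_on K (\<lambda>i. hd_app (s i))"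
  shows "\<exists>g. s \<longlonglongrightarrow> g"
proof -
  define G where "G z = (if z \<in> ball 0 1 then lim (\<lambda>i. hd_app (s i) z) else 0)" for z
  have lim: "uniform_limit K (\<lambda>i. hd_app (s i)) G sequentially" if K: "compact K" "K \<subseteq> ball 0 1" for K
  proof -
    have "uniform_limit K (\<lambda>i. hd_app (s i)) (\<lambda>z. lim (\<lambda>i. hd_app (s i) z)) sequentially"
      using cauchy[OF K] Cauchy_uniformly_convergent uniformly_convergent_uniform_limit_iff by blast
    then show ?thesis
      by (rule uniform_limit_cong'[THEN iffD1, rotated -1]) (use K in \<open>auto simp: G_def\<close>)
  qed
  have "G holomorphic_on ball 0 1"
  proof (rule holomorphic_uniform_sequence)
    show "hd_app (s i) holomorphic_on ball 0 1" for i
      using hd_app[of "s i"] by simp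
    show "\<exists>d>0. cball z d \<subseteq> ball 0 1 \<and> uniform_limit (cball z d) (\<lambda>i. hd_app (s i)) G sequentially"
      if "z \<in> ball 0 1" for z
      using that lim open_contains_cball[of "ball 0 1"] by (metis compact_cball open_ball)
  qed simp
  then have "hd_app (Abs_hol_disc G) = G"
    by (subst Abs_hol_disc_inverse) (auto simp: G_def)
  then show ?thesis
    using lim by (metis tendsto_hol_disc_iff)
qed

subsection \<open>Normed spaces of holomorphic functions\<close>

locale normed_hol =
  fixes E :: "hol_disc set" and n :: "hol_disc \<Rightarrow> real"
  assumes norm_on: "norm_on E n"
begin

sublocale Metric_space E "norm_dist E n"
  by (rule Metric_space_norm_dist[OF norm_on])

lemma subspace: "hd.subspace E"
  and norm_ge_0: "f \<in> E \<Longrightarrow> 0 \<le> n f"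
  and norm_eq_0: "f \<in> E \<Longrightarrow> n f = 0 \<longleftrightarrow> f = 0"
  and norm_scale: "f \<in> E \<Longrightarrow> n (hd_scale c f) = cmod c * n f"
  and norm_triangle: "f \<in> E \<Longrightarrow> g \<in> E \<Longrightarrow> n (f + g) \<le> n f + n g"
  using norm_on by (auto simp: norm_on_def)

lemmas zero_mem = hd.subspace_0[OF subspace]
  and diff_mem = hd.subspace_diff[OF subspace]
  and add_mem = hd.subspace_add[OF subspace]
  and scale_mem = hd.subspace_scale[OF subspace]

lemma norm_0: "n 0 = 0"
  using norm_eq_0 zero_mem by blast

lemma norm_diff_commute: "f \<in> E \<Longrightarrow> g \<in> E \<Longrightarrow> n (f - g) = n (g - f)"
  using commute[of f g] by (simp add: norm_dist_def)

lemma norm_diff_triangle: "f \<in> E \<Longrightarrow> g \<in> E \<Longrightarrow> n (f - g) \<le> n f + n g"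
  using norm_triangle[of f "0 - g"] norm_diff_commute[of 0 g] diff_mem[of 0 g] zero_mem by simp

lemma norm_dist_eq: "f \<in> E \<Longrightarrow> g \<in> E \<Longrightarrow> norm_dist E n f g = n (f - g)"
  by (simp add: norm_dist_def)

lemma topspace_norm_topology [simp]: "topspace (norm_topology E n) = E"
  by (simp add: norm_topology_def)

lemma bound_of_ball_bound:
  assumes "\<delta> > 0" and ball: "\<And>f. f \<in> E \<Longrightarrow> n f < \<delta> \<Longrightarrow> z \<in> K \<Longrightarrow> cmod (hd_app f z) \<le> B"
    and f: "f \<in> E" and z: "z \<in> K"
  shows "cmod (hd_app f z) \<le> 2 * B / \<delta> * n f"
proof (cases "f = 0")
  case True
  then show ?thesis by (simp add: norm_0 zero_hol_disc.rep_eq)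
next
  case False
  then have pos: "n f > 0"
    using f norm_eq_0 norm_ge_0 by fastforce
  define c where "c = \<delta> / (2 * n f)"
  have c: "c > 0" using pos \<open>\<delta> > 0\<close> by (simp add: c_def)
  have "n (hd_scale (complex_of_real c) f) = \<delta> / 2"
    using f pos c by (simp add: norm_scale) (simp add: c_def)
  then have "cmod (hd_app (hd_scale (complex_of_real c) f) z) \<le> B"
    using ball[of "hd_scale (complex_of_real c) f"] scale_mem f z \<open>\<delta> > 0\<close> by simp
  then have "c * cmod (hd_app f z) \<le> B"
    using c by (simp add: hd_app_scale norm_mult)
  then show ?thesis
    using pos \<open>\<delta> > 0\<close> by (simp add: c_def field_simps)
qed

lemma continuous_inclusion_iff:
  "continuous_inclusion E n \<longleftrightarrow>
    (\<forall>K. compact K \<longrightarrow> K \<subseteq> ball 0 1 \<longrightarrow> (\<exists>C. \<forall>f\<in>E. \<forall>z\<in>K. cmod (hd_app f z) \<le> C * n f))"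
proof (intro iffI allI impI)
  fix K :: "complex set"
  assume cont: "continuous_inclusion E n" and K: "compact K" "K \<subseteq> ball 0 1"
  let ?U = "{g. \<forall>z\<in>K. cmod (hd_app g z - hd_app 0 z) < 1}"
  have "openin mtopology {f \<in> E. f \<in> ?U}"
    using openin_continuous_map_preimage[OF cont[unfolded continuous_inclusion_def], of ?U]
      open_uniform_nbhd[OF K, of 0 1]
    unfolding topspace_norm_topology by (simp only: norm_topology_def open_openin)
  moreover have "0 \<in> {f \<in> E. f \<in> ?U}"
    by (simp add: zero_mem)
  ultimately obtain r where r: "r > 0" "mball 0 r \<subseteq> {f \<in> E. f \<in> ?U}"
    unfolding openin_mtopology by blast
  have ball: "cmod (hd_app f z) \<le> 1" if "f \<in> E" "n f < r" "z \<in> K" for f z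
  proof -
    have "f \<in> mball 0 r"
      using that norm_diff_commute[of f 0] by (simp add: in_mball zero_mem norm_dist_eq)
    then show ?thesis
      using subsetD[OF r(2)] that(3) by (fastforce simp: zero_hol_disc.rep_eq)
  qed
  show "\<exists>C. \<forall>f\<in>E. \<forall>z\<in>K. cmod (hd_app f z) \<le> C * n f"
    using bound_of_ball_bound[OF r(1), of _ K 1] ball by blast
next
  assume bound: "\<forall>K. compact K \<longrightarrow> K \<subseteq> ball 0 1 \<longrightarrow> (\<exists>C. \<forall>f\<in>E. \<forall>z\<in>K. cmod (hd_app f z) \<le> C * n f)"
  have "openin mtopology {f \<in> E. f \<in> U}" if "open U" for U
    unfolding openin_mtopology
  proof (intro conjI allI impI)
    fix f assume f: "f \<in> {f \<in> E. f \<in> U}"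
    then have "\<exists>K e. compact K \<and> K \<subseteq> ball 0 1 \<and> e > 0 \<and>
        (\<forall>h. (\<forall>z\<in>K. cmod (hd_app h z - hd_app f z) < e) \<longrightarrow> h \<in> U)"
      using \<open>open U\<close> unfolding open_hol_disc_def by blast
    then obtain K e where K: "compact K" "K \<subseteq> ball 0 1" "e > 0"
      and U: "\<And>h. (\<forall>z\<in>K. cmod (hd_app h z - hd_app f z) < e) \<Longrightarrow> h \<in> U"
      by (elim exE conjE) blast
    obtain C where C: "\<And>f z. f \<in> E \<Longrightarrow> z \<in> K \<Longrightarrow> cmod (hd_app f z) \<le> C * n f"
      using bound K by meson
    have "mball f (e / (\<bar>C\<bar> + 1)) \<subseteq> {f \<in> E. f \<in> U}"
    proof
      fix g assume "g \<in> mball f (e / (\<bar>C\<bar> + 1))"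
      then have g: "g \<in> E" "n (g - f) < e / (\<bar>C\<bar> + 1)"
        using f by (auto simp: in_mball norm_dist_eq norm_diff_commute)
      have "cmod (hd_app g z - hd_app f z) < e" if "z \<in> K" for z
      proof -
        have gf: "g - f \<in> E" using f g diff_mem by simp
        have "cmod (hd_app g z - hd_app f z) \<le> C * n (g - f)"
          using C[OF gf that] by (simp add: hd_app_diff)
        also have "\<dots> \<le> (\<bar>C\<bar> + 1) * n (g - f)"
          using norm_ge_0[OF gf] by (intro mult_right_mono) auto
        also have "\<dots> < e"
          using g(2) by (simp add: field_simps)
        finally show ?thesis .
      qed
      then show "g \<in> {f \<in> E. f \<in> U}"
        using U g(1) by simp
    qed
    moreover have "e / (\<bar>C\<bar> + 1) > 0" using K by simp
    ultimately show "\<exists>r>0. mball f r \<subseteq> {f \<in> E. f \<in> U}" by blast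
  qed auto
  then show "continuous_inclusion E n"
    by (simp add: continuous_inclusion_def continuous_map_def norm_topology_def)
qed

lemma tendsto_of_norm_tendsto:
  assumes cont: "continuous_inclusion E n" and s: "\<And>i. s i \<in> E" "g \<in> E"
    and lim: "((\<lambda>i. n (s i - g)) \<longlongrightarrow> 0) F"
  shows "(s \<longlongrightarrow> g) F"
proof -
  have "limitin mtopology s g F"
    using s lim by (simp add: limitin_metric_dist_null norm_dist_eq)
  from continuous_map_limit[OF cont[unfolded continuous_inclusion_def norm_topology_def] this]
  have "limitin euclidean ((\<lambda>f. f) \<circ> s) g F" .
  then show ?thesis by (simp add: o_def)
qed

lemma mcomplete_iff:
  "mcomplete \<longleftrightarrow> (\<forall>s. (\<forall>i. s i \<in> E) \<longrightarrow> (\<forall>e>0. \<exists>N. \<forall>i\<ge>N. \<forall>j\<ge>N. n (s i - s j) < e) \<longrightarrow>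
     (\<exists>g\<in>E. (\<lambda>i. n (s i - g)) \<longlonglongrightarrow> 0))"
proof -
  have "MCauchy s \<longleftrightarrow> (\<forall>i. s i \<in> E) \<and> (\<forall>e>0. \<exists>N. \<forall>i\<ge>N. \<forall>j\<ge>N. n (s i - s j) < e)" for s
    unfolding MCauchy_def by (auto simp: norm_dist_def image_subset_iff)
  moreover have "limitin mtopology s g sequentially \<longleftrightarrow> g \<in> E \<and> (\<lambda>i. n (s i - g)) \<longlonglongrightarrow> 0"
    if "\<forall>i. s i \<in> E" for s g
    using that by (auto simp: limitin_metric_dist_null norm_dist_eq)
  ultimately show ?thesis
    unfolding mcomplete_def by blast
qed

lemma delta_mem_dual_space:
  assumes cont: "continuous_inclusion E n" and z: "z \<in> ball 0 1"
  shows "delta E z \<in> dual_space E n"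
proof -
  have "continuous_on UNIV (\<lambda>f. hd_app f z)"
    unfolding continuous_on_def using tendsto_hd_app[OF tendsto_ident_at z] by blast
  then have ev: "continuous_map euclidean euclidean (\<lambda>f. hd_app f z)"
    by simp
  have "continuous_map (norm_topology E n) euclidean ((\<lambda>f. hd_app f z) \<circ> (\<lambda>f. f))"
    by (rule continuous_map_compose[OF cont[unfolded continuous_inclusion_def] ev])
  then have "continuous_map (norm_topology E n) euclidean (delta E z)"
    by (rule continuous_map_eq) (simp add: delta_def)
  then show ?thesis
    by (simp add: dual_space_def delta_def add_mem scale_mem hd_app_scale plus_hol_disc.rep_eq)
qed

lemma norm_le_dual_norm:
  assumes \<phi>: "\<phi> \<in> dual_space E n" and f: "f \<in> E" "n f \<le> 1"
  shows "cmod (\<phi> f) \<le> dual_norm E n \<phi>"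
proof -
  have scale: "\<And>c f. f \<in> E \<Longrightarrow> \<phi> (hd_scale c f) = c * \<phi> f"
    and cont: "continuous_map mtopology euclidean \<phi>"
    using \<phi> by (auto simp: dual_space_def norm_topology_def)
  have "\<phi> 0 = 0"
    using scale[OF zero_mem, of 0] by simp
  moreover have "openin mtopology {f \<in> E. \<phi> f \<in> ball 0 1}"
    using openin_continuous_map_preimage[OF cont, of "ball 0 1"] by simp
  ultimately obtain r where r: "r > 0" "mball 0 r \<subseteq> {f \<in> E. \<phi> f \<in> ball 0 1}"
    using zero_mem unfolding openin_mtopology by auto
  have "cmod (\<phi> g) \<le> 2 / r" if g: "g \<in> E" "n g \<le> 1" for g
  proof -
    let ?g = "hd_scale (complex_of_real (r / 2)) g"
    have "n ?g < r"
    proof -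
      have "n ?g = r / 2 * n g" using r(1) norm_scale[OF g(1), of "complex_of_real (r / 2)"]
        by (simp del: of_real_divide)
      also have "\<dots> \<le> r / 2 * 1" using g r(1) by (intro mult_left_mono) auto
      finally show ?thesis using r(1) by simp
    qed
    then have "?g \<in> mball 0 r"
      using scale_mem[OF g(1)] norm_diff_commute[of ?g 0] by (simp add: in_mball zero_mem norm_dist_eq)
    then have "cmod (\<phi> ?g) < 1"
      using subsetD[OF r(2)] by fastforce
    then show ?thesis
      using r(1) by (simp add: scale[OF g(1)] norm_mult norm_divide field_simps)
  qed
  then have "bdd_above ((\<lambda>f. cmod (\<phi> f)) ` {f \<in> E. n f \<le> 1})"
    by (intro bdd_aboveI[where M = "2 / r"]) blast
  then show ?thesis
    unfolding dual_norm_def by (rule cSUP_upper2) (use f in auto)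
qed

lemma continuous_inclusion_iff_bounded_deltas:
  "continuous_inclusion E n \<longleftrightarrow>
    delta E ` ball 0 1 \<subseteq> dual_space E n \<and>
    (\<forall>K. compact K \<and> K \<subseteq> ball 0 1 \<longrightarrow> bounded_in_dual E n (delta E ` K))" (is "?L \<longleftrightarrow> ?R")
proof
  assume cont: ?L
  have dual: "delta E ` ball 0 1 \<subseteq> dual_space E n"
    using delta_mem_dual_space[OF cont] by blast
  have "bounded_in_dual E n (delta E ` K)" if K: "compact K" "K \<subseteq> ball 0 1" for K
  proof -
    obtain C where C: "\<forall>f\<in>E. \<forall>z\<in>K. cmod (hd_app f z) \<le> C * n f"
      using cont K unfolding continuous_inclusion_iff by meson
    have "dual_norm E n (delta E z) \<le> \<bar>C\<bar>" if z: "z \<in> K" for z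
      unfolding dual_norm_def
    proof (rule cSUP_least)
      show "{f \<in> E. n f \<le> 1} \<noteq> {}"
        using zero_mem norm_0 by fastforce
      fix f assume f: "f \<in> {f \<in> E. n f \<le> 1}"
      then have "cmod (hd_app f z) \<le> C * n f" using C z by blast
      also have "\<dots> \<le> \<bar>C\<bar> * 1"
        using f norm_ge_0[of f] by (intro mult_mono) auto
      finally show "cmod (delta E z f) \<le> \<bar>C\<bar>"
        using f by (simp add: delta_def)
    qed
    then show ?thesis
      using dual K(2) unfolding bounded_in_dual_def by blast
  qed
  then show ?R using dual by blast
next
  assume R: ?R
  show ?L
    unfolding continuous_inclusion_iff
  proof (intro allI impI)
    fix K :: "complex set" assume K: "compact K" "K \<subseteq> ball 0 1"
    then have "bounded_in_dual E n (delta E ` K)"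
      using R by simp
    then obtain M where M: "\<And>z. z \<in> K \<Longrightarrow> dual_norm E n (delta E z) \<le> M"
      by (auto simp: bounded_in_dual_def)
    have "cmod (hd_app f z) \<le> M" if "f \<in> E" "n f < 1" "z \<in> K" for f z
    proof -
      have "delta E z \<in> dual_space E n" using R K that by blast
      from norm_le_dual_norm[OF this that(1)] that M[OF that(3)] show ?thesis
        by (simp add: delta_def)
    qed
    then show "\<exists>C. \<forall>f\<in>E. \<forall>z\<in>K. cmod (hd_app f z) \<le> C * n f"
      using bound_of_ball_bound[of 1 _ K M] by fastforce
  qed
qed

subsection \<open>The closed graph theorem for the inclusion\<close>

lemma Baire_approximation:
  assumes complete: "mcomplete" and K: "compact K" "K \<subseteq> ball 0 1" and e: "e > 0"
  shows "\<exists>\<delta>>0. \<forall>g\<in>E. n g < \<delta> \<longrightarrow>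
    (\<forall>\<eta>>0. \<exists>w\<in>E. n (g - w) < \<eta> \<and> (\<forall>z\<in>K. cmod (hd_app w z) \<le> e))"
proof -
  define A where "A k = {f \<in> E. \<forall>z\<in>K. cmod (hd_app f z) \<le> real k}" for k
  have "\<exists>k. mtopology interior_of (mtopology closure_of A k) \<noteq> {}"
  proof (rule ccontr)
    assume "\<not> ?thesis"
    then have "mtopology interior_of \<Union>(range (\<lambda>k. mtopology closure_of A k)) = {}"
      by (intro metric_Baire_category_alt[OF complete]) auto
    moreover have "\<Union>(range (\<lambda>k. mtopology closure_of A k)) = E"
    proof
      show "\<Union>(range (\<lambda>k. mtopology closure_of A k)) \<subseteq> E"
        using closure_of_subset_topspace[of mtopology] by auto
      show "E \<subseteq> \<Union>(range (\<lambda>k. mtopology closure_of A k))"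
      proof
        fix f assume f: "f \<in> E"
        obtain B where B: "\<And>z. z \<in> K \<Longrightarrow> cmod (hd_app f z) \<le> B"
          using hd_app_bounded_on_compact[OF K] by blast
        obtain k where "B \<le> real k" using real_arch_simple by blast
        then have "f \<in> A k" using f B unfolding A_def by fastforce
        moreover have "A k \<subseteq> mtopology closure_of A k"
          by (rule closure_of_subset) (auto simp: A_def)
        ultimately show "f \<in> \<Union>(range (\<lambda>k. mtopology closure_of A k))" by blast
      qed
    qed
    ultimately show False
      using interior_of_topspace[of mtopology] zero_mem by auto
  qed
  then obtain k f0 where "f0 \<in> mtopology interior_of (mtopology closure_of A k)" by blast
  moreover have "openin mtopology (mtopology interior_of (mtopology closure_of A k))" by simp
  ultimately obtain r where r: "r > 0"
    and interior: "mball f0 r \<subseteq> mtopology interior_of (mtopology closure_of A k)"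
    and f0: "f0 \<in> E"
    unfolding openin_mtopology by blast
  have ball: "mball f0 r \<subseteq> mtopology closure_of A k"
    by (rule subset_trans[OF interior interior_of_subset])
  have near: "\<exists>u\<in>A k. n (f - u) < \<eta>" if f: "f \<in> mball f0 r" and \<eta>: "\<eta> > 0" for f \<eta>
  proof -
    have "f \<in> mtopology closure_of A k" using ball f by blast
    then obtain u where "u \<in> A k" "u \<in> mball f \<eta>"
      using \<eta> unfolding metric_closure_of by blast
    then show ?thesis by (auto simp: norm_dist_eq)
  qed
  have approx: "\<exists>w\<in>E. n (g - w) < \<eta> \<and> (\<forall>z\<in>K. cmod (hd_app w z) \<le> 2 * real k)"
    if g: "g \<in> E" "n g < r" and \<eta>: "\<eta> > 0" for g \<eta>
  proof -
    have fg: "f0 + g \<in> mball f0 r" "f0 \<in> mball f0 r"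
      using f0 g r norm_diff_commute[OF f0 add_mem[OF f0 g(1)]] add_mem[OF f0 g(1)]
      by (auto simp: norm_dist_eq norm_0)
    obtain u where u: "u \<in> A k" "n (f0 + g - u) < \<eta> / 2"
      using near[OF fg(1), of "\<eta> / 2"] \<eta> by auto
    obtain v where v: "v \<in> A k" "n (f0 - v) < \<eta> / 2"
      using near[OF fg(2), of "\<eta> / 2"] \<eta> by auto
    have uv: "u \<in> E" "v \<in> E" using u v by (auto simp: A_def)
    have "n (g - (u - v)) = n ((f0 + g - u) - (f0 - v))"
      by (simp add: algebra_simps)
    also have "\<dots> \<le> n (f0 + g - u) + n (f0 - v)"
      using f0 g uv by (intro norm_diff_triangle diff_mem add_mem)
    finally have "n (g - (u - v)) < \<eta>" using u v by simp
    moreover have "cmod (hd_app (u - v) z) \<le> 2 * real k" if "z \<in> K" for z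
    proof -
      have "cmod (hd_app u z) \<le> real k" "cmod (hd_app v z) \<le> real k"
        using u v that by (auto simp: A_def)
      then show ?thesis
        using norm_triangle_ineq4[of "hd_app u z" "hd_app v z"] by (simp add: hd_app_diff)
    qed
    ultimately show ?thesis using diff_mem[OF uv] by blast
  qed
  define c where "c = e / (2 * real k + 1)"
  have c: "c > 0" using e by (simp add: c_def)
  have ck: "c * (2 * real k) \<le> e"
    using e by (simp add: c_def field_simps)
  show ?thesis
  proof (intro exI[of _ "c * r"] conjI ballI impI allI)
    show "c * r > 0" using c r by simp
    fix g \<eta> assume g: "g \<in> E" "n g < c * r" and \<eta>: "(\<eta>::real) > 0"
    let ?g = "hd_scale (complex_of_real (inverse c)) g"
    have "n ?g = inverse c * n g"
      using c norm_scale[OF g(1), of "complex_of_real (inverse c)"] by (simp del: of_real_inverse)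
    also have "\<dots> < r"
      using g c by (simp add: field_simps)
    finally have "n ?g < r" .
    then obtain w where w: "w \<in> E" "n (?g - w) < \<eta> / c" "\<forall>z\<in>K. cmod (hd_app w z) \<le> 2 * real k"
      using approx[OF scale_mem[OF g(1)] _ divide_pos_pos[OF \<eta> c]] by blast
    let ?w = "hd_scale (complex_of_real c) w"
    have "hd_scale (complex_of_real c) ?g = g"
      using c by simp
    then have "g - ?w = hd_scale (complex_of_real c) (?g - w)"
      by (simp only: hd.scale_right_diff_distrib)
    then have "n (g - ?w) = c * n (?g - w)"
      using c by (simp add: norm_scale[OF diff_mem[OF scale_mem[OF g(1)] w(1)]] del: hd.scale_scale)
    also have "\<dots> < \<eta>" using w(2) c by (simp add: field_simps)
    finally have "n (g - ?w) < \<eta>" .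
    moreover have "cmod (hd_app ?w z) \<le> e" if "z \<in> K" for z
    proof -
      have "cmod (hd_app ?w z) = c * cmod (hd_app w z)"
        using c by (simp add: hd_app_scale norm_mult)
      also have "\<dots> \<le> c * (2 * real k)"
        using w(3) that c by (intro mult_left_mono) auto
      finally show ?thesis using ck by simp
    qed
    ultimately show "\<exists>w\<in>E. n (g - w) < \<eta> \<and> (\<forall>z\<in>K. cmod (hd_app w z) \<le> e)"
      using scale_mem[OF w(1)] by blast
  qed
qed

theorem closed_graph_inclusion:
  assumes complete: "mcomplete"
    and closed: "\<And>s g h. (\<And>i. s i \<in> E) \<Longrightarrow> g \<in> E \<Longrightarrow> (\<lambda>i::nat. n (s i - g)) \<longlonglongrightarrow> 0 \<Longrightarrow>
      s \<longlonglongrightarrow> h \<Longrightarrow> g = h"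
  shows "continuous_inclusion E n"
  unfolding continuous_inclusion_iff
proof (intro allI impI)
  fix K :: "complex set" assume K: "compact K" "K \<subseteq> ball 0 1"
  define L :: "nat \<Rightarrow> complex set" where "L j = cball 0 (1 - inverse (real (Suc j)))" for j
  have L: "compact (L j)" "L j \<subseteq> ball 0 1" for j
    by (auto simp: L_def simp del: of_nat_Suc elim!: le_less_trans)
  have L_mono: "L i \<subseteq> L j" if "i \<le> j" for i j
    using that unfolding L_def by (intro subset_cball diff_left_mono le_imp_inverse_le) auto
  have exhaust: "\<exists>i. J \<subseteq> L i" if J: "compact J" "J \<subseteq> ball 0 1" for J
  proof (cases "J = {}")
    case False
    have "continuous_on J cmod" by (intro continuous_intros)
    from continuous_attains_sup[OF J(1) False this]
    obtain x where x: "x \<in> J" "\<forall>z\<in>J. cmod z \<le> cmod x" by (elim bexE)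
    then have "1 - cmod x > 0" using J by auto
    then obtain i where "inverse (real (Suc i)) < 1 - cmod x"
      using reals_Archimedean by blast
    then have "J \<subseteq> L i" using x(2) by (fastforce simp: L_def)
    then show ?thesis by blast
  qed auto
  obtain i where i: "K \<subseteq> L i" using exhaust[OF K] by blast
  define good where "good j \<delta> \<longleftrightarrow> (\<forall>g\<in>E. n g < \<delta> \<longrightarrow>
    (\<forall>\<eta>>0. \<exists>w\<in>E. n (g - w) < \<eta> \<and> (\<forall>z\<in>L (i + j). cmod (hd_app w z) \<le> (1/2) ^ j)))"
    for j :: nat and \<delta> :: real
  have "\<exists>\<delta>>0. \<delta> \<le> inverse (real (Suc j)) \<and> good j \<delta>" for j
  proof -
    obtain \<delta> where "\<delta> > 0" "good j \<delta>"
      using Baire_approximation[OF complete L, of "(1/2) ^ j" "i + j"] unfolding good_def by auto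
    then show ?thesis
      by (intro exI[of _ "min \<delta> (inverse (real (Suc j)))"]) (auto simp: good_def)
  qed
  then obtain \<delta> where \<delta>: "\<And>j. \<delta> j > 0" "\<And>j. \<delta> j \<le> inverse (real (Suc j))" "\<And>j. good j (\<delta> j)"
    by metis
  have bound: "cmod (hd_app g z) \<le> 2" if g: "g \<in> E" "n g < \<delta> 0" and z: "z \<in> L i" for g z
  proof -
    have "\<exists>s. \<forall>j. (s j \<in> E \<and> n (g - s j) < \<delta> j \<and> (j = 0 \<longrightarrow> s j = 0)) \<and>
        (\<forall>z\<in>L (i + j). cmod (hd_app (s (Suc j)) z - hd_app (s j) z) \<le> (1/2) ^ j)"
    proof (rule dependent_nat_choice)
      show "\<exists>s. s \<in> E \<and> n (g - s) < \<delta> 0 \<and> ((0::nat) = 0 \<longrightarrow> s = 0)"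
        using g zero_mem by auto
      fix s j assume s: "s \<in> E \<and> n (g - s) < \<delta> j \<and> (j = 0 \<longrightarrow> s = 0)"
      then obtain w where w: "w \<in> E" "n (g - s - w) < \<delta> (Suc j)"
        "\<forall>z\<in>L (i + j). cmod (hd_app w z) \<le> (1/2) ^ j"
        using \<delta>(3)[of j] \<delta>(1)[of "Suc j"] diff_mem[of g s] g unfolding good_def by blast
      show "\<exists>s'. (s' \<in> E \<and> n (g - s') < \<delta> (Suc j) \<and> (Suc j = 0 \<longrightarrow> s' = 0)) \<and>
          (\<forall>z\<in>L (i + j). cmod (hd_app s' z - hd_app s z) \<le> (1/2) ^ j)"
        by (rule exI[of _ "s + w"])
          (use w s add_mem in \<open>simp add: plus_hol_disc.rep_eq diff_diff_add\<close>)
    qed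
    then obtain s where s: "\<And>j. s j \<in> E" "\<And>j. n (g - s j) < \<delta> j" "s 0 = 0"
      and step: "\<And>j z. z \<in> L (i + j) \<Longrightarrow> cmod (hd_app (s (Suc j)) z - hd_app (s j) z) \<le> (1/2) ^ j"
      by metis
    have est: "cmod (hd_app (s (j + k)) z - hd_app (s j) z) \<le> 2 * (1/2) ^ j - 2 * (1/2) ^ (j + k)"
      if z: "z \<in> L (i + j)" for j k z
    proof (induction k)
      case (Suc k)
      have "z \<in> L (i + (j + k))" using z L_mono[of "i + j" "i + (j + k)"] by auto
      from step[OF this]
      have "cmod (hd_app (s (Suc (j + k))) z - hd_app (s (j + k)) z) \<le> (1/2) ^ (j + k)" .
      then show ?case
        using Suc norm_triangle_ineq[of "hd_app (s (Suc (j + k))) z - hd_app (s (j + k)) z"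
            "hd_app (s (j + k)) z - hd_app (s j) z"] by simp
    qed simp
    have "\<exists>h. s \<longlonglongrightarrow> h"
    proof (rule hol_disc_complete)
      fix J :: "complex set" assume "compact J" "J \<subseteq> ball 0 1"
      then obtain p where p: "J \<subseteq> L p" using exhaust by blast
      show "uniformly_Cauchy_on J (\<lambda>j. hd_app (s j))"
      proof (rule uniformly_Cauchy_onI')
        fix e :: real assume "e > 0"
        then obtain q where q: "(1/2) ^ q < e / 2"
          using real_arch_pow_inv[of "e / 2" "1/2"] by auto
        have "dist (hd_app (s a) z) (hd_app (s b) z) < e"
          if z: "z \<in> J" and a: "a \<ge> max p q" and b: "b > a" for z a b
        proof -
          have "z \<in> L (i + a)" using z p a L_mono[of p "i + a"] by auto
          from est[OF this, of "b - a"] b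
          have "cmod (hd_app (s b) z - hd_app (s a) z) \<le> 2 * (1/2) ^ a - 2 * (1/2) ^ b" by simp
          moreover have "(1/2 :: real) ^ a \<le> (1/2) ^ q"
            using a by (intro power_decreasing) auto
          moreover have "(1/2 :: real) ^ b > 0" by simp
          ultimately have "cmod (hd_app (s b) z - hd_app (s a) z) < e" using q by linarith
          then show ?thesis by (simp add: dist_norm norm_minus_commute)
        qed
        then show "\<exists>M. \<forall>z\<in>J. \<forall>a\<ge>M. \<forall>b>a. dist (hd_app (s a) z) (hd_app (s b) z) < e" by blast
      qed
    qed
    then obtain h where h: "s \<longlonglongrightarrow> h" by blast
    have "(\<lambda>j. n (s j - g)) \<longlonglongrightarrow> 0"
    proof (rule tendsto_sandwich[OF _ _ tendsto_const LIMSEQ_inverse_real_of_nat])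
      show "\<forall>\<^sub>F j in sequentially. 0 \<le> n (s j - g)"
        using norm_ge_0 diff_mem s(1) g(1) by simp
      have "n (s j - g) \<le> inverse (real (Suc j))" for j
        using s(2)[of j] \<delta>(2)[of j] norm_diff_commute[OF s(1) g(1), of j] by simp
      then show "\<forall>\<^sub>F j in sequentially. n (s j - g) \<le> inverse (real (Suc j))" by simp
    qed
    then have "g = h" using closed[OF s(1) g(1) _ h] by blast
    moreover have "z \<in> ball 0 1" using z L by blast
    ultimately have lim: "(\<lambda>k. hd_app (s k) z) \<longlonglongrightarrow> hd_app g z"
      using tendsto_hd_app[OF h] by simp
    have "cmod (hd_app (s k) z) \<le> 2" for k
    proof -
      have "cmod (hd_app (s (0 + k)) z - hd_app (s 0) z) \<le> 2 * (1/2) ^ 0 - 2 * (1/2) ^ (0 + k)"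
        by (rule est) (use z in simp)
      then have "cmod (hd_app (s k) z) \<le> 2 - 2 * (1/2) ^ k"
        using s(3) by (simp add: zero_hol_disc.rep_eq)
      also have "\<dots> \<le> 2" by simp
      finally show ?thesis .
    qed
    then show ?thesis
      by (intro Lim_norm_ubound[OF _ lim]) auto
  qed
  then have ball: "cmod (hd_app f z) \<le> 2" if "f \<in> E" "n f < \<delta> 0" "z \<in> K" for f z
    using that i by blast
  show "\<exists>C. \<forall>f\<in>E. \<forall>z\<in>K. cmod (hd_app f z) \<le> C * n f"
    using bound_of_ball_bound[OF \<delta>(1) ball] by blast
qed

end

subsection \<open>Optimal domains\<close>

lemma norm_on_optimal_domain:
  assumes n: "norm_on X n" and T: "Vector_Spaces.linear hd_scale hd_scale T" "inj T"
  shows "norm_on (optimal_domain T X) (optimal_norm T n)"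
proof -
  interpret T: Vector_Spaces.linear hd_scale hd_scale T by fact
  interpret X: normed_hol X n by standard (fact n)
  have "T f = 0 \<longleftrightarrow> f = 0" for f
    using injD[OF T(2), of f 0] T.zero by auto
  then show ?thesis
    unfolding norm_on_def
    by (auto simp: optimal_domain_def optimal_norm_def hd.subspace_def T.add T.scale T.zero
        X.zero_mem X.add_mem X.scale_mem X.norm_ge_0 X.norm_eq_0 X.norm_scale X.norm_triangle)
qed

lemma optimal_domain_inclusion_iff_complete:
  assumes X: "banach_space_of_analytic_functions X n"
    and T: "continuous_linear_operator T" "inj T"
  shows "continuous_inclusion (optimal_domain T X) (optimal_norm T n) \<longleftrightarrow>
    banach_space_on (optimal_domain T X) (optimal_norm T n)"
proof -
  let ?E = "optimal_domain T X" and ?n = "optimal_norm T n"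
  have norm_X: "norm_on X n" and complete_X: "Metric_space.mcomplete X (norm_dist X n)"
    and cont_X: "continuous_inclusion X n"
    using X by (auto simp: banach_space_of_analytic_functions_def banach_space_on_def)
  interpret T: Vector_Spaces.linear hd_scale hd_scale T
    using T(1) by (simp add: continuous_linear_operator_def)
  interpret X: normed_hol X n by standard (fact norm_X)
  have norm_E: "norm_on ?E ?n"
    by (rule norm_on_optimal_domain[OF norm_X T.linear_axioms T(2)])
  interpret E: normed_hol ?E ?n by standard (fact norm_E)
  have mem: "f \<in> ?E \<longleftrightarrow> T f \<in> X" for f by (simp add: optimal_domain_def)
  have norm_diff: "?n (f - g) = n (T f - T g)" for f g
    by (simp add: optimal_norm_def T.diff)
  have T_lim: "(\<lambda>i. T (s i)) \<longlonglongrightarrow> T g" if "s \<longlonglongrightarrow> g" for s :: "nat \<Rightarrow> hol_disc" and g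
    using T(1) that unfolding continuous_linear_operator_def
    by (intro continuous_on_tendsto_compose[of UNIV T s g]) auto
  show ?thesis
  proof
    assume cont: "continuous_inclusion ?E ?n"
    have "E.mcomplete"
      unfolding E.mcomplete_iff
    proof (intro allI impI)
      fix s :: "nat \<Rightarrow> hol_disc"
      assume s: "\<forall>i. s i \<in> ?E"
        and cauchy: "\<forall>e>0. \<exists>N. \<forall>i\<ge>N. \<forall>j\<ge>N. ?n (s i - s j) < e"
      have "\<exists>g. s \<longlonglongrightarrow> g"
      proof (rule hol_disc_complete)
        fix K :: "complex set" assume K: "compact K" "K \<subseteq> ball 0 1"
        obtain C where C: "\<forall>f\<in>?E. \<forall>z\<in>K. cmod (hd_app f z) \<le> C * ?n f"
          using cont K unfolding E.continuous_inclusion_iff by meson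
        show "uniformly_Cauchy_on K (\<lambda>i. hd_app (s i))"
        proof (rule uniformly_Cauchy_onI')
          fix e :: real assume "e > 0"
          then have "e / (\<bar>C\<bar> + 1) > 0" by simp
          then obtain N where N: "\<forall>i\<ge>N. \<forall>j\<ge>N. ?n (s i - s j) < e / (\<bar>C\<bar> + 1)"
            using cauchy by meson
          have "dist (hd_app (s i) z) (hd_app (s j) z) < e"
            if "z \<in> K" "i \<ge> N" "j > i" for z i j
          proof -
            have E: "s i - s j \<in> ?E" using s E.diff_mem by blast
            have "dist (hd_app (s i) z) (hd_app (s j) z) \<le> C * ?n (s i - s j)"
              using C E that(1) by (simp add: dist_norm hd_app_diff[symmetric])
            also have "\<dots> \<le> (\<bar>C\<bar> + 1) * ?n (s i - s j)"
              using E.norm_ge_0[OF E] by (intro mult_right_mono) auto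
            also have "\<dots> < e"
              using N[rule_format, of i j] that by (simp add: field_simps)
            finally show ?thesis .
          qed
          then show "\<exists>M. \<forall>z\<in>K. \<forall>i\<ge>M. \<forall>j>i. dist (hd_app (s i) z) (hd_app (s j) z) < e" by blast
        qed
      qed
      then obtain g where g: "s \<longlonglongrightarrow> g" by blast
      have TX: "\<And>i. T (s i) \<in> X" using s mem by blast
      moreover have "\<forall>e>0. \<exists>N. \<forall>i\<ge>N. \<forall>j\<ge>N. n (T (s i) - T (s j)) < e"
        using cauchy by (simp only: norm_diff)
      ultimately obtain h where h: "h \<in> X" "(\<lambda>i. n (T (s i) - h)) \<longlonglongrightarrow> 0"
        using complete_X[unfolded X.mcomplete_iff, rule_format, of "\<lambda>i. T (s i)"] by auto
      have "(\<lambda>i. T (s i)) \<longlonglongrightarrow> h"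
        by (rule X.tendsto_of_norm_tendsto[OF cont_X TX h])
      then have "T g = h"
        using hol_disc_tendsto_unique[OF T_lim[OF g]] by simp
      then show "\<exists>g\<in>?E. (\<lambda>i. ?n (s i - g)) \<longlonglongrightarrow> 0"
        using h by (intro bexI[of _ g]) (auto simp: norm_diff mem)
    qed
    then show "banach_space_on ?E ?n"
      using norm_E by (simp add: banach_space_on_def)
  next
    assume "banach_space_on ?E ?n"
    then have "E.mcomplete" by (simp add: banach_space_on_def)
    then show "continuous_inclusion ?E ?n"
    proof (rule E.closed_graph_inclusion)
      fix s :: "nat \<Rightarrow> hol_disc" and g h
      assume s: "\<And>i. s i \<in> ?E" and g: "g \<in> ?E" and lim: "(\<lambda>i. ?n (s i - g)) \<longlonglongrightarrow> 0"
        and h: "s \<longlonglongrightarrow> h"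
      have "(\<lambda>i. T (s i)) \<longlonglongrightarrow> T g"
        by (rule X.tendsto_of_norm_tendsto[OF cont_X]) (use s g lim in \<open>simp_all add: mem norm_diff\<close>)
      then have "T g = T h"
        using hol_disc_tendsto_unique[OF _ T_lim[OF h]] by simp
      then show "g = h" using T(2) by (simp add: inj_eq)
    qed
  qed
qed

theorem proposition2p7:
  fixes X :: "hol_disc set" and normX :: "hol_disc \<Rightarrow> real" and T :: "hol_disc \<Rightarrow> hol_disc"
  defines "TX \<equiv> optimal_domain T X" and "normTX \<equiv> optimal_norm T normX"
  defines "prop_i \<equiv> continuous_inclusion TX normTX"
    and "prop_ii \<equiv> delta TX ` ball 0 1 \<subseteq> dual_space TX normTX \<and>
      (\<forall>K. compact K \<and> K \<subseteq> ball 0 1 \<longrightarrow> bounded_in_dual TX normTX (delta TX ` K))"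
    and "prop_iii \<equiv> banach_space_on TX normTX"
  assumes "banach_space_of_analytic_functions X normX"
    and "continuous_linear_operator T"
    and "inj T"
    and "T ` X \<subseteq> X"
  shows "norm_on TX normTX \<and>
    (prop_i \<longleftrightarrow> prop_ii) \<and> (prop_ii \<longleftrightarrow> prop_iii) \<and>
    (prop_i \<or> prop_ii \<or> prop_iii \<longrightarrow>
      banach_space_of_analytic_functions TX normTX \<and>
      delta TX ` ball 0 1 \<subseteq> dual_space TX normTX)"
proof -
  have norm: "norm_on TX normTX"
    unfolding TX_def normTX_def using assms(6-8)
    by (intro norm_on_optimal_domain)
      (auto simp: banach_space_of_analytic_functions_def banach_space_on_def
        continuous_linear_operator_def)
  then interpret normed_hol TX normTX by unfold_locales
  have i_ii: "prop_i \<longleftrightarrow> prop_ii"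
    unfolding prop_i_def prop_ii_def by (rule continuous_inclusion_iff_bounded_deltas)
  moreover have i_iii: "prop_i \<longleftrightarrow> prop_iii"
    unfolding prop_i_def prop_iii_def TX_def normTX_def
    by (rule optimal_domain_inclusion_iff_complete[OF assms(6-8)])
  moreover have "banach_space_of_analytic_functions TX normTX \<and>
      delta TX ` ball 0 1 \<subseteq> dual_space TX normTX" if prop_i
    using that i_ii i_iii unfolding prop_i_def prop_ii_def prop_iii_def
    by (simp add: banach_space_of_analytic_functions_def)
  ultimately show ?thesis
    using norm by blast
qed

end
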